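(* Let $a,b$ be coprime positive integers, $n\ge1$, let $P\in\mathfrak{D}_n^{(a,b)}$ with step sequence $\mathfrak{u}_P$, let $Q\in\{P_0,P_1\}$ where $P_0$ and $P_1$ are the lowest and highest paths of $\mathfrak{D}_n^{(a,b)}$, and let $\mathfrak{u}'_P$ be $\mathfrak{u}_{P_0}-\mathfrak{u}_P$ if $Q=P_0$ and $\mathfrak{u}_P$ if $Q=P_1$. Let $\mu$ be the multi-permutation obtained from $\mathfrak{u}'_P$ as described in the context. Then: (1) $\mu$ is a $b$-Stirling permutation (of size $an$); (2) $\mu=\zeta_a(\mathfrak{u}'_P)$.
   Context: **Dyck paths.** $\mathfrak{D}_n^{(a,b)}$ is the set of lattice paths from $(0,0)$ to $(bn,an)$ with unit steps $N=(0,1)$, $E=(1,0)$ staying weakly above $y=ax/b$. The step sequence $\mathfrak{u}_P=(u_1,\ldots,u_{an})$ records the $x$-coordinate $u_k$ of the $k$-th $N$ step; it is weakly increasing with $0\le u_k\le b(k-1)/a$. The lowest path $P_0$ has step sequence $u_k=\lfloor b(k-1)/a\rfloor$ and the highest path $P_1=N^{an}E^{bn}$ has step sequence $(0,\ldots,0)$. **$b$-Stirling permutation of size $M$.** A permutation of the multiset $\{1^b,\ldots,M^b\}$ in which every letter $j\ne i$ occurring between two $i$'s satisfies $j>i$. **Maps $\zeta$, $\zeta_a$.** For a sequence $\mathfrak{u}=(u_1,\ldots,u_M)$ of integers with $0\le u_k\le b(k-1)$, $\zeta(\mathfrak{u})$ is the word obtained by starting with the empty word and, for $k=1,\ldots,M$,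 inserting $k^b$ right after the first $u_k$ letters of the current word. $\zeta_a(\mathfrak{u}):=\zeta(au_1,\ldots,au_M)$. **Construction of $\mu$.** Define sequences $\mathbf{v}_1,\ldots,\mathbf{v}_b$ of length $an$ by (ceilings entrywise) $$\mathbf{v}_1=\left\lceil \tfrac{a}{b}\,\mathfrak{u}'_P\right\rceil,\qquad \mathbf{v}_i=\left\lceil \frac{a\,\mathfrak{u}'_P-\sum_{j=1}^{i-1}\mathbf{v}_j}{b-i+1}\right\rceil\quad(2\le i\le b).$$ For a sequence $v=(v_1,\ldots,v_M)$ of integers with $0\le v_i\le i-1$, let $\eta(v)=(w_1,\ldots,w_M)$ be the permutation of $[1,M]$ obtained as follows: start with $S=\{1,\ldots,M\}$; for $i=M,M-1,\ldots,1$ let $w_i$ be the $(v_i+1)$-th smallest element of $S$ and replace $S$ by $S\setminus\{w_i\}$. Put $\mathbf{w}_i=\eta(\mathbf{v}_i)$ and let $\mathbf{w}'_i=(w'_{i,1},\ldots,w'_{i,an})$ be the inverse permutation of $\mathbf{w}_i$. Finally $\mu=(\mu_1,\ldots,\mu_{abn})$ is defined by $\mu_{b(p-1)+q}=w'_{q,p}$ for $1\le p\le an$, $1\le q\le b$. *)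

theory Defs
  imports Complex_Main "HOL-Library.Multiset"
begin

text \<open>
  Sequences and words are lists. The mathematics indexes them from 1, lists from 0: the entry
  $u_k$ is \<open>u ! (k - 1)\<close>. Letters of permutations and multi-permutations are the numbers 1, 2, ...
\<close>

subsection \<open>Rational Dyck paths\<close>

datatype step = North | East

text \<open>
  Being weakly above the line $y = ax/b$ is required at all lattice points of the path, i.e. at
  the end points of all its prefixes; since the line is increasing and the steps are axis-parallel
  unit steps, this covers the points in between.
\<close>

definition dyck_paths :: "nat \<Rightarrow> nat \<Rightarrow> nat \<Rightarrow> step list set" where
  "dyck_paths a b n =
     {P. count_list P North = a * n \<and> count_list P East = b * n \<and>
         (\<forall>i\<le>length P. real (count_list (take i P) North)
                        \<ge> real a * real (count_list (take i P) East) / real b)}"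

text \<open>\<open>step_seq_from x P\<close>: the $x$-coordinates of the north steps of \<open>P\<close> when \<open>P\<close> starts at abscissa \<open>x\<close>.\<close>

fun step_seq_from :: "nat \<Rightarrow> step list \<Rightarrow> nat list" where
  "step_seq_from x [] = []"
| "step_seq_from x (North # P) = x # step_seq_from x P"
| "step_seq_from x (East # P) = step_seq_from (Suc x) P"

definition step_seq :: "step list \<Rightarrow> nat list" where
  "step_seq P = step_seq_from 0 P"

text \<open>
  The path from abscissa \<open>x\<close> to abscissa \<open>m\<close> with a prescribed (weakly increasing) step sequence.
\<close>

fun path_from :: "nat \<Rightarrow> nat list \<Rightarrow> nat \<Rightarrow> step list" where
  "path_from x [] m = replicate (m - x) East"
| "path_from x (u # us) m = replicate (u - x) East @ North # path_from u us m"

definition lowest_path :: "nat \<Rightarrow> nat \<Rightarrow> nat \<Rightarrow> step list" where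
  "lowest_path a b n = path_from 0 (map (\<lambda>k. b * (k - 1) div a) [1..<a * n + 1]) (b * n)"

definition highest_path :: "nat \<Rightarrow> nat \<Rightarrow> nat \<Rightarrow> step list" where
  "highest_path a b n = replicate (a * n) North @ replicate (b * n) East"

lemma step_seq_from_replicate_East:
  "step_seq_from x (replicate k East @ P) = step_seq_from (x + k) P"
  by (induction k arbitrary: x) auto

lemma step_seq_from_path_from:
  "sorted (x # us) \<Longrightarrow> step_seq_from x (path_from x us m) = us"
proof (induction us arbitrary: x)
  case Nil
  then show ?case using step_seq_from_replicate_East[of x "m - x" "[]"] by simp
qed (simp add: step_seq_from_replicate_East)

lemma count_list_replicate_step: "count_list (replicate k x) y = (if x = y then k else 0)"
  by (induction k) auto

lemma count_path_from:
  assumes "sorted (x # us @ [m])"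
  shows "count_list (path_from x us m) North = length us"
    and "count_list (path_from x us m) East = m - x"
  using assms
proof (induction us arbitrary: x)
  case (Cons u us)
  { case 1 show ?case using Cons.IH(1)[of u] 1 by (simp add: count_list_replicate_step) }
  { case 2
    then have "u \<le> m" "x \<le> u" by auto
    with Cons.IH(2)[of u] 2 show ?case by (simp add: count_list_replicate_step) }
qed (simp_all add: count_list_replicate_step)

lemma prefix_path_from:
  assumes "sorted (x # us @ [m])"
  shows "x + count_list (take i (path_from x us m)) East
           \<le> (us @ [m]) ! count_list (take i (path_from x us m)) North"
  using assms
proof (induction us arbitrary: x i)
  case Nil
  then show ?case by (auto simp: count_list_replicate_step min_def)
next
  case (Cons u us)
  have xu: "x \<le> u" using Cons.prems by simp
  show ?case
  proof (cases "i \<le> u - x")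
    case True
    then show ?thesis using xu by (simp add: count_list_replicate_step min_def)
  next
    case False
    then obtain j where i: "i = (u - x) + Suc j"
      by (metis less_imp_Suc_add not_le add_Suc_right)
    show ?thesis using Cons.IH[of u j] Cons.prems xu
      by (simp add: i count_list_replicate_step)
  qed
qed

lemma lowest_steps_nth:
  assumes "a > 0" and "h \<le> a * n"
  shows "(map (\<lambda>k. b * (k - 1) div a) [1..<a * n + 1] @ [b * n]) ! h = b * h div a"
  using assms by (cases "h = a * n") (auto simp: nth_append mult.left_commute simp del: upt_Suc)

lemma lowest_steps_sorted:
  assumes "a > 0"
  shows "sorted (0 # map (\<lambda>k. b * (k - 1) div a) [1..<a * n + 1] @ [b * n])"
proof -
  let ?us = "map (\<lambda>k. b * (k - 1) div a) [1..<a * n + 1] @ [b * n]"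
  have "?us ! i \<le> ?us ! j" if "i \<le> j" "j < length ?us" for i j
  proof -
    from that have "i \<le> a * n" "j \<le> a * n" by (simp_all del: upt_Suc)
    with that show ?thesis
      by (simp only: lowest_steps_nth[OF assms] div_le_mono mult_le_mono2)
  qed
  then have "sorted ?us" unfolding sorted_iff_nth_mono by blast
  then show ?thesis by simp
qed

lemma step_seq_lowest_path:
  assumes "a > 0"
  shows "step_seq (lowest_path a b n) = map (\<lambda>k. b * (k - 1) div a) [1..<a * n + 1]"
  unfolding step_seq_def lowest_path_def
  using lowest_steps_sorted[OF assms, of b n]
  by (intro step_seq_from_path_from) (simp add: sorted_append del: upt_Suc)

lemma lowest_path_in_dyck_paths:
  assumes "a > 0" and "b > 0"
  shows "lowest_path a b n \<in> dyck_paths a b n"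
proof -
  let ?P = "lowest_path a b n"
  note s = lowest_steps_sorted[OF assms(1), of b n]
  have N: "count_list ?P North = a * n" and E: "count_list ?P East = b * n"
    using count_path_from[OF s] by (simp_all add: lowest_path_def del: upt_Suc)
  have "a * count_list (take i ?P) East \<le> b * count_list (take i ?P) North" for i
  proof -
    have "count_list (take i ?P) North \<le> a * n"
      using N by (metis append_take_drop_id count_list_append le_add1)
    then have "count_list (take i ?P) East \<le> b * count_list (take i ?P) North div a"
      using prefix_path_from[OF s, of i] lowest_steps_nth[OF assms(1)]
      by (simp add: lowest_path_def del: upt_Suc)
    then show ?thesis
      by (metis assms(1) less_eq_div_iff_mult_less_eq mult.commute)
  qed
  then have "real a * real (count_list (take i ?P) East)
               \<le> real b * real (count_list (take i ?P) North)" for i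
    by (metis of_nat_le_iff of_nat_mult)
  then show ?thesis
    using N E assms(2) by (auto simp: dyck_paths_def field_simps)
qed

lemma step_seq_highest_path: "step_seq (highest_path a b n) = replicate (a * n) 0"
proof -
  have "step_seq_from x (replicate k North @ P) = replicate k x @ step_seq_from x P" for x k P
    by (induction k) auto
  then show ?thesis
    using step_seq_from_replicate_East[of 0 "b * n" "[]"]
    by (simp add: step_seq_def highest_path_def)
qed

lemma highest_path_in_dyck_paths:
  assumes "b > 0"
  shows "highest_path a b n \<in> dyck_paths a b n"
  using assms
  by (auto simp: dyck_paths_def highest_path_def count_list_replicate_step field_simps min_def
      simp flip: of_nat_mult)

lemma step_seq_from_prefix:
  "k < length (step_seq_from x P) \<Longrightarrow>
     \<exists>i\<le>length P. count_list (take i P) North = k \<and>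
                    x + count_list (take i P) East = step_seq_from x P ! k"
proof (induction x P arbitrary: k rule: step_seq_from.induct)
  case (2 x P)
  show ?case
  proof (cases k)
    case 0
    then show ?thesis by (intro exI[of _ 0]) simp
  next
    case (Suc k')
    with 2 obtain i where "i \<le> length P" "count_list (take i P) North = k'"
      "x + count_list (take i P) East = step_seq_from x P ! k'" by auto
    with Suc show ?thesis by (intro exI[of _ "Suc i"]) simp
  qed
next
  case (3 x P)
  then obtain i where "i \<le> length P" "count_list (take i P) North = k"
    "Suc x + count_list (take i P) East = step_seq_from (Suc x) P ! k" by auto
  then show ?case by (intro exI[of _ "Suc i"]) simp
qed simp

lemma length_step_seq_from: "length (step_seq_from x P) = count_list P North"
  by (induction x P rule: step_seq_from.induct) auto

lemma length_step_seq: "P \<in> dyck_paths a b n \<Longrightarrow> length (step_seq P) = a * n"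
  by (simp add: step_seq_def length_step_seq_from dyck_paths_def)

text \<open>Together with \<open>step_seq_lowest_path\<close> this says that \<open>lowest_path\<close> is the lowest path.\<close>

lemma step_seq_nth_le:
  assumes "a > 0" and "b > 0" and P: "P \<in> dyck_paths a b n" and "k < a * n"
  shows "step_seq P ! k \<le> b * k div a"
proof -
  have "k < length (step_seq_from 0 P)"
    using assms(4) length_step_seq[OF P] by (simp add: step_seq_def)
  then obtain i where i: "i \<le> length P" "count_list (take i P) North = k"
    "count_list (take i P) East = step_seq P ! k"
    using step_seq_from_prefix[of k 0 P] by (auto simp: step_seq_def)
  then have "real a * real (step_seq P ! k) / real b \<le> real k"
    using P by (auto simp: dyck_paths_def)
  then have "real (a * (step_seq P ! k)) \<le> real (b * k)"
    using assms(2) by (simp add: field_simps)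
  then show ?thesis
    using assms(1) by (simp only: of_nat_le_iff less_eq_div_iff_mult_less_eq mult.commute)
qed

text \<open>
  The sequence $u'_P$ for \<open>Q\<close> the lowest or the highest path. Should the two paths coincide, they
  are the only Dyck path and both cases give the zero sequence.
\<close>

definition rel_step_seq :: "nat \<Rightarrow> nat \<Rightarrow> nat \<Rightarrow> step list \<Rightarrow> step list \<Rightarrow> int list" where
  "rel_step_seq a b n Q P =
     (if Q = lowest_path a b n
      then map2 (\<lambda>x y. int x - int y) (step_seq (lowest_path a b n)) (step_seq P)
      else map int (step_seq P))"


subsection \<open>Stirling permutations and the maps zeta\<close>

definition is_stirling_perm :: "nat \<Rightarrow> nat \<Rightarrow> nat list \<Rightarrow> bool" where
  "is_stirling_perm b M w \<longleftrightarrow>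
     mset w = (\<Sum>i\<in>{1..M}. replicate_mset b i) \<and>
     (\<forall>x y z. x < y \<and> y < z \<and> z < length w \<and> w ! x = w ! z \<and> w ! y \<noteq> w ! x
        \<longrightarrow> w ! y > w ! x)"

definition zeta :: "nat \<Rightarrow> int list \<Rightarrow> nat list" where
  "zeta b u =
     foldl (\<lambda>w k. take (nat (u ! (k - 1))) w @ replicate b k @ drop (nat (u ! (k - 1))) w)
       [] [1..<length u + 1]"

definition zeta_scaled :: "nat \<Rightarrow> nat \<Rightarrow> int list \<Rightarrow> nat list" where
  "zeta_scaled a b u = zeta b (map (\<lambda>x. int a * x) u)"


subsection \<open>The multi-permutation mu\<close>

text \<open>
  \<open>v_entry a b x i\<close> is the entry of $v_i$ at a position where $u'_P$ has the entry \<open>x\<close>, for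
  \<open>1 \<le> i \<le> b\<close>. For \<open>i = 1\<close> the sum is empty and this is the ceiling of $(a/b)x$.
\<close>

fun v_entry :: "nat \<Rightarrow> nat \<Rightarrow> int \<Rightarrow> nat \<Rightarrow> int" where
  "v_entry a b x i =
     \<lceil>(real a * real_of_int x - (\<Sum>j\<in>{1..<i}. real_of_int (v_entry a b x j)))
        / (real b - real i + 1)\<rceil>"

declare v_entry.simps [simp del]

definition v_seq :: "nat \<Rightarrow> nat \<Rightarrow> int list \<Rightarrow> nat \<Rightarrow> int list" where
  "v_seq a b u i = map (\<lambda>x. v_entry a b x i) u"

text \<open>
  \<open>eta_aux\<close> receives the sequence reversed and returns $w_M, w_{M-1}, \ldots, w_1$. The
  $(x+1)$-th smallest element of a finite set is the entry with index \<open>x\<close> of its sorted list.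
\<close>

fun eta_aux :: "nat set \<Rightarrow> int list \<Rightarrow> nat list" where
  "eta_aux S [] = []"
| "eta_aux S (x # xs) =
     (let w = sorted_list_of_set S ! nat x in w # eta_aux (S - {w}) xs)"

definition eta :: "int list \<Rightarrow> nat list" where
  "eta v = rev (eta_aux {1..length v} (rev v))"

definition inverse_perm :: "nat list \<Rightarrow> nat list" where
  "inverse_perm w =
     map (\<lambda>p. THE i. i \<in> {1..length w} \<and> w ! (i - 1) = p) [1..<length w + 1]"

text \<open>The $p$-th block of \<open>b\<close> letters consists of the $p$-th entries of the \<open>b\<close> inverse permutations.\<close>

definition mu :: "nat \<Rightarrow> nat \<Rightarrow> int list \<Rightarrow> nat list" where
  "mu a b u =
     concat (map (\<lambda>p. map (\<lambda>q. inverse_perm (eta (v_seq a b u q)) ! (p - 1)) [1..<b + 1])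
               [1..<length u + 1])"

end

theory Submission
  imports Defs
begin

text \<open>
  The theorem is a statement about residue classes of positions. Inserting the block $k^b$ into a
  word shifts the letters behind it by \<open>b\<close> places, so no letter ever changes its position modulo
  \<open>b\<close>. The word \<open>zeta b u\<close> therefore splits into \<open>b\<close> subwords, one for each residue class of
  positions, and these grow independently: the subword of the positions congruent to \<open>q\<close> receives
  one letter \<open>k\<close>, behind as many of its letters as there are numbers congruent to \<open>q\<close> in
  $\{1,\ldots,u_k\}$, namely $\lfloor (u_k + b - q)/b \rfloor$. Hence it is the word \<open>zeta 1 v\<close>
  for the sequence \<open>v\<close> of these floors (\<open>zeta_nth_residue_class\<close>).

  Two observations identify these subwords with the ingredients of \<open>mu\<close>. The recursively defined
  ceilings distribute $a u_k$ over \<open>b\<close> summands as evenly as possible, larger summands first, and so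
  the $q$-th of them is $\lfloor (a u_k + b - q)/b \rfloor$ (\<open>v_entry_eq\<close>). And building a
  permutation by successive insertion of 1, 2, ... behind prescribed numbers of letters is inverse
  to selecting elements by rank from a shrinking set (\<open>inverse_perm_eta\<close>). Since \<open>mu\<close> lists the
  letters of the subwords in turn, it is \<open>zeta_scaled a b u\<close>.

  The Stirling property is inherited from insertion to insertion, because each new block is
  contiguous and its letter is larger than all letters present (\<open>is_stirling_perm_zeta\<close>).
\<close>

section \<open>Insertion of a block into a word\<close>

definition insert_block :: "nat \<Rightarrow> nat \<Rightarrow> 'a \<Rightarrow> 'a list \<Rightarrow> 'a list" where
  "insert_block b m k w = take m w @ replicate b k @ drop m w"

lemma length_insert_block [simp]: "length (insert_block b m k w) = length w + b"
  by (simp add: insert_block_def)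

lemma insert_block_nth:
  assumes "m \<le> length w" "i < length w + b"
  shows "insert_block b m k w ! i = (if i < m then w ! i else if i < m + b then k else w ! (i - b))"
  using assms by (auto simp: insert_block_def nth_append)

lemma mset_insert_block: "mset (insert_block b m k w) = mset w + replicate_mset b k"
proof -
  have "mset w = mset (take m w) + mset (drop m w)"
    by (metis append_take_drop_id mset_append)
  then show ?thesis by (simp add: insert_block_def)
qed

text \<open>
  These bounds on the entries guarantee that each insertion takes place inside the current word.
\<close>

definition insertion_seq :: "nat \<Rightarrow> int list \<Rightarrow> bool" where
  "insertion_seq b u \<longleftrightarrow> (\<forall>k<length u. 0 \<le> u ! k \<and> u ! k \<le> int b * int k)"

lemma insertion_seq_snoc:
  "insertion_seq b (u @ [x]) \<longleftrightarrow> insertion_seq b u \<and> 0 \<le> x \<and> x \<le> int b * int (length u)"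
  by (auto simp: insertion_seq_def nth_append less_Suc_eq)

lemma zeta_Nil [simp]: "zeta b [] = []"
  by (simp add: zeta_def)

lemma zeta_snoc: "zeta b (u @ [x]) = insert_block b (nat x) (Suc (length u)) (zeta b u)"
proof -
  have "foldl (\<lambda>w k. take (nat ((u @ [x]) ! (k - 1))) w @ replicate b k
                        @ drop (nat ((u @ [x]) ! (k - 1))) w) [] [1..<length u + 1] = zeta b u"
    unfolding zeta_def by (rule foldl_cong) (auto simp: nth_append simp del: upt_Suc)
  then show ?thesis
    unfolding zeta_def by (simp add: insert_block_def)
qed

lemma length_zeta [simp]: "length (zeta b u) = b * length u"
  by (induction u rule: rev_induct) (auto simp: zeta_snoc)

lemma mset_zeta: "mset (zeta b u) = (\<Sum>i\<in>{1..length u}. replicate_mset b i)"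
  by (induction u rule: rev_induct) (auto simp: zeta_snoc mset_insert_block)

lemma set_zeta: "b > 0 \<Longrightarrow> set (zeta b u) = {1..length u}"
  using arg_cong[OF mset_zeta[of b u], of set_mset] by (auto simp: set_mset_sum)


section \<open>The Stirling property\<close>

definition stirling_word :: "nat list \<Rightarrow> bool" where
  "stirling_word w \<longleftrightarrow>
     (\<forall>x y z. x < y \<and> y < z \<and> z < length w \<and> w ! x = w ! z \<and> w ! y \<noteq> w ! x \<longrightarrow> w ! x < w ! y)"

text \<open>
  A maximal new letter cannot violate the condition between two equal old letters, and no old
  letter can come between two letters of the new block, as that block is contiguous. Old letters
  keep their relative order.
\<close>

lemma stirling_word_insert_block:
  assumes "stirling_word w"
    and max: "\<And>i. i < length w \<Longrightarrow> w ! i < k"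
    and m: "m \<le> length w"
  shows "stirling_word (insert_block b m k w)"
  unfolding stirling_word_def length_insert_block
proof (intro allI impI, elim conjE)
  fix x y z
  let ?W = "insert_block b m k w"
  assume xyz: "x < y" "y < z" "z < length w + b"
    and eq: "?W ! x = ?W ! z" and neq: "?W ! y \<noteq> ?W ! x"
  have old: "w ! i < w ! j"
    if "i < j" "j < l" "l < length w" "w ! i = w ! l" "w ! j \<noteq> w ! i" for i j l
    using assms(1) that unfolding stirling_word_def by blast
  define in_block where "in_block i \<longleftrightarrow> m \<le> i \<and> i < m + b" for i
  \<comment> \<open>The position in the old word of a letter outside the new block.\<close>
  define g where "g i = (if i < m then i else i - b)" for i
  have new: "?W ! i = k" if "in_block i" "i < length w + b" for i
    using that m by (auto simp: insert_block_nth in_block_def)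
  have outside: "?W ! i = w ! g i \<and> g i < length w" if "\<not> in_block i" "i < length w + b" for i
    using that m by (auto simp: insert_block_nth in_block_def g_def)
  have mono: "g i < g j" if "i < j" "\<not> in_block i" "\<not> in_block j" for i j
    using that by (auto simp: g_def in_block_def)
  have len: "x < length w + b" "y < length w + b" using xyz by auto
  show "?W ! x < ?W ! y"
  proof (cases "in_block x \<or> in_block z")
    case True
    then have "in_block x" "in_block z"
      using new[of x] new[of z] outside[of x] outside[of z] max len xyz eq
      by (metis less_irrefl)+
    then have "in_block y" using xyz by (auto simp: in_block_def)
    then show ?thesis using new[of x] new[of y] \<open>in_block x\<close> len neq by simp
  next
    case False
    then have x: "?W ! x = w ! g x" "g x < length w" and z: "?W ! z = w ! g z" "g z < length w"
      using outside len xyz by auto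
    show ?thesis
    proof (cases "in_block y")
      case True
      then show ?thesis using new[of y] len x max by simp
    next
      case y: False
      then show ?thesis
        using outside[of y] len x z False eq neq xyz mono[of x y] mono[of y z]
          old[of "g x" "g y" "g z"] by auto
    qed
  qed
qed

lemma is_stirling_perm_zeta:
  assumes "insertion_seq b u"
  shows "is_stirling_perm b (length u) (zeta b u)"
proof (cases "b = 0")
  case True
  then have "length (zeta b u) = 0" by simp
  then have "zeta b u = []" by (simp only: length_0_conv)
  then show ?thesis using True by (simp add: is_stirling_perm_def)
next
  case False
  have "stirling_word (zeta b u)"
    using assms
  proof (induction u rule: rev_induct)
    case Nil
    show ?case by (simp add: stirling_word_def)
  next
    case (snoc x u)
    let ?w = "zeta b u"
    have u: "insertion_seq b u" "0 \<le> x" "x \<le> int b * int (length u)"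
      using snoc.prems by (simp_all add: insertion_seq_snoc)
    have m: "nat x \<le> length ?w" using u by (simp add: nat_le_iff)
    have max: "?w ! i < Suc (length u)" if "i < length ?w" for i
      using nth_mem[OF that] False by (simp add: set_zeta)
    show ?case
      unfolding zeta_snoc using snoc.IH[OF u(1)] max m by (rule stirling_word_insert_block)
  qed
  then show ?thesis by (simp add: is_stirling_perm_def stirling_word_def mset_zeta)
qed


section \<open>Insertion and selection by rank are inverse to each other\<close>

lemma remove1_nth_distinct:
  assumes "distinct xs" "i < length xs"
  shows "remove1 (xs ! i) xs = take i xs @ drop (Suc i) xs"
  using assms
proof (induction xs arbitrary: i)
  case (Cons x xs)
  then show ?case by (cases i) auto
qed simp

lemma sorted_list_of_set_remove_nth:
  assumes "finite S" "i < card S"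
  shows "sorted_list_of_set (S - {sorted_list_of_set S ! i})
           = take i (sorted_list_of_set S) @ drop (Suc i) (sorted_list_of_set S)"
  using assms by (simp add: sorted_list_of_set_remove remove1_nth_distinct)

lemma length_eta_aux [simp]: "length (eta_aux S xs) = length xs"
  by (induction S xs rule: eta_aux.induct) (auto simp: Let_def)

text \<open>
  The last number is the first one for which an element is selected, and for an arbitrary set \<open>S\<close>
  of selectable elements the statement survives the removal of this element: it takes the place
  with index \<open>x\<close> out of the sorted list of \<open>S\<close>, just as the insertion of the last
  letter creates the place with index \<open>x\<close> in the word.
\<close>

lemma rev_eta_aux_nth_zeta:
  assumes "insertion_seq 1 v" "finite S" "card S = length v" "j < length v"
  shows "rev (eta_aux S (rev v)) ! (zeta 1 v ! j - 1) = sorted_list_of_set S ! j"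
  using assms
proof (induction v arbitrary: S j rule: rev_induct)
  case (snoc x v)
  let ?s = "sorted_list_of_set S"
  let ?S = "S - {?s ! nat x}"
  have v: "insertion_seq 1 v" and x: "nat x \<le> length v" "nat x < card S"
    using snoc.prems by (auto simp: insertion_seq_snoc)
  have S: "card ?S = length v" "finite ?S"
    using snoc.prems x nth_mem[of "nat x" ?s] by (auto simp: card_Diff_singleton)
  have s: "sorted_list_of_set ?S = take (nat x) ?s @ drop (Suc (nat x)) ?s"
    using sorted_list_of_set_remove_nth[OF snoc.prems(2) x(2)] .
  have IH: "rev (eta_aux ?S (rev v)) ! (zeta 1 v ! i - 1) = sorted_list_of_set ?S ! i
              \<and> zeta 1 v ! i - 1 < length v" if "i < length v" for i
    using snoc.IH[OF v S(2) S(1) that] set_zeta[of 1 v] nth_mem[of i "zeta 1 v"] that by auto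
  have eta: "rev (eta_aux S (rev (v @ [x]))) = rev (eta_aux ?S (rev v)) @ [?s ! nat x]"
    by (simp add: Let_def)
  have len: "length ?s = Suc (length v)" using snoc.prems by simp
  have zeta: "zeta 1 (v @ [x]) ! j = (if j < nat x then zeta 1 v ! j
                 else if j < nat x + 1 then Suc (length v) else zeta 1 v ! (j - 1))"
    using snoc.prems x by (simp add: zeta_snoc insert_block_nth)
  consider "j < nat x" | "j = nat x" | "nat x < j" by linarith
  then show ?case
  proof cases
    case 1
    then show ?thesis unfolding eta zeta using IH[of j] x len by (simp add: nth_append s)
  next
    case 2
    then show ?thesis unfolding eta zeta by (simp add: nth_append)
  next
    case 3
    then obtain r where r: "j = Suc r" by (cases j) auto
    then show ?thesis unfolding eta zeta using 3 IH[of r] x len snoc.prems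
      by (simp add: nth_append s)
  qed
qed simp

lemma eta_nth_zeta:
  assumes "insertion_seq 1 v" "j < length v"
  shows "eta v ! (zeta 1 v ! j - 1) = Suc j"
proof -
  have "sorted_list_of_set {1..length v} = [1..<Suc (length v)]"
    by (metis atLeastLessThanSuc_atLeastAtMost sorted_list_of_set_range)
  then show ?thesis
    using rev_eta_aux_nth_zeta[of v "{1..length v}" j] assms
    by (simp add: eta_def del: upt_Suc)
qed

theorem inverse_perm_eta:
  assumes "insertion_seq 1 v"
  shows "inverse_perm (eta v) = zeta 1 v"
proof (rule nth_equalityI)
  have len: "length (eta v) = length v" by (simp add: eta_def)
  then show "length (inverse_perm (eta v)) = length (zeta 1 v)"
    by (simp add: inverse_perm_def del: upt_Suc)
  fix j assume "j < length (inverse_perm (eta v))"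
  then have j: "j < length v" using len by (simp add: inverse_perm_def del: upt_Suc)
  have "(THE i. i \<in> {1..length v} \<and> eta v ! (i - 1) = Suc j) = zeta 1 v ! j"
  proof (rule the_equality)
    show "zeta 1 v ! j \<in> {1..length v} \<and> eta v ! (zeta 1 v ! j - 1) = Suc j"
      using eta_nth_zeta[OF assms j] set_zeta[of 1 v] nth_mem[of j "zeta 1 v"] j by simp
  next
    fix i assume i: "i \<in> {1..length v} \<and> eta v ! (i - 1) = Suc j"
    then have "i \<in> set (zeta 1 v)" by (simp add: set_zeta)
    then obtain j' where "j' < length v" "i = zeta 1 v ! j'"
      unfolding in_set_conv_nth length_zeta by auto
    then show "i = zeta 1 v ! j" using i eta_nth_zeta[OF assms, of j'] by simp
  qed
  then show "inverse_perm (eta v) ! j = zeta 1 v ! j"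
    using j by (simp add: inverse_perm_def len del: upt_Suc)
qed


section \<open>The subwords of a word on the residue classes of positions\<close>

text \<open>
  For \<open>1 \<le> q \<le> b\<close> and \<open>x \<ge> 0\<close> this is the number of elements of \<open>{1..x}\<close> that are congruent to
  \<open>q\<close> modulo \<open>b\<close>.
\<close>

definition class_count :: "nat \<Rightarrow> nat \<Rightarrow> int \<Rightarrow> int" where
  "class_count b q x = (x + int b - int q) div int b"

text \<open>
  Counting from 0, the positive number with index \<open>p\<close> in the class of \<open>q\<close> is \<open>b * p + q\<close>, so more
  than \<open>p\<close> of them are at most \<open>x\<close> iff this one is.
\<close>

lemma less_class_count_iff:
  assumes "b > 0"
  shows "int p < class_count b q x \<longleftrightarrow> int b * int p + int q \<le> x"
proof -
  have "int p < class_count b q x \<longleftrightarrow> int p + 1 \<le> (x + int b - int q) div int b"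
    by (auto simp: class_count_def)
  also have "\<dots> \<longleftrightarrow> (int p + 1) * int b \<le> x + int b - int q"
  proof
    assume "int p + 1 \<le> (x + int b - int q) div int b"
    then have "(int p + 1) * int b \<le> (x + int b - int q) div int b * int b"
      by (intro mult_right_mono) simp_all
    also have "\<dots> \<le> x + int b - int q"
      using assms by (simp add: minus_mod_eq_div_mult[symmetric])
    finally show "(int p + 1) * int b \<le> x + int b - int q" .
  next
    assume "(int p + 1) * int b \<le> x + int b - int q"
    then have "(int p + 1) * int b div int b \<le> (x + int b - int q) div int b"
      using assms by (intro zdiv_mono1) simp_all
    then show "int p + 1 \<le> (x + int b - int q) div int b" using assms by simp
  qed
  finally show ?thesis by (simp add: algebra_simps)
qed

lemma insertion_seq_class_count:
  assumes "insertion_seq b u" "1 \<le> q" "q \<le> b"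
  shows "insertion_seq 1 (map (class_count b q) u)"
  unfolding insertion_seq_def
proof (intro allI impI)
  fix k assume k: "k < length (map (class_count b q) u)"
  then have u: "0 \<le> u ! k" "u ! k \<le> int b * int k"
    using assms(1) by (auto simp: insertion_seq_def)
  have "\<not> int k < class_count b q (u ! k)"
    using less_class_count_iff[of b k q "u ! k"] assms u by simp
  moreover have "0 \<le> class_count b q (u ! k)"
    using assms u by (simp add: class_count_def pos_imp_zdiv_nonneg_iff)
  ultimately show "0 \<le> map (class_count b q) u ! k \<and> map (class_count b q) u ! k \<le> int 1 * int k"
    using k by simp
qed

text \<open>
  Among any \<open>b\<close> consecutive positions exactly one belongs to the residue class of \<open>q\<close>. So the
  insertion of a block restricts to the insertion of a single letter, and the letters in front of
  it are those of the class among the first \<open>x\<close> letters.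
\<close>

lemma zeta_nth_residue_class:
  assumes "insertion_seq b u" "1 \<le> q" "q \<le> b" "p < length u"
  shows "zeta b u ! (b * p + (q - 1)) = zeta 1 (map (class_count b q) u) ! p"
  using assms
proof (induction u arbitrary: p rule: rev_induct)
  case (snoc x u)
  have b: "b > 0" using snoc.prems by simp
  define c where "c = nat (class_count b q x)"
  let ?i = "b * p + (q - 1)"
  have u: "insertion_seq b u" and x: "0 \<le> x" "x \<le> int b * int (length u)"
    using snoc.prems(1) by (simp_all add: insertion_seq_snoc)
  have c: "c \<le> length u"
    using insertion_seq_class_count[OF snoc.prems(1-3)] by (simp add: insertion_seq_snoc c_def nat_le_iff)
  have m: "nat x \<le> b * length u" using x by (simp add: nat_le_iff)
  have front: "r < c \<longleftrightarrow> b * r + (q - 1) < nat x" for r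
  proof -
    have "r < c \<longleftrightarrow> int b * int r + int q \<le> x"
      using less_class_count_iff[OF b, of r q x] by (auto simp: c_def)
    also have "\<dots> \<longleftrightarrow> int (b * r + q) \<le> x" by simp
    also have "\<dots> \<longleftrightarrow> b * r + q \<le> nat x" using x by linarith
    also have "\<dots> \<longleftrightarrow> b * r + (q - 1) < nat x" using snoc.prems(2) by linarith
    finally show ?thesis .
  qed
  have "b * Suc p \<le> b * Suc (length u)" using snoc.prems by (intro mult_le_mono2) simp
  then have i: "?i < b * length u + b" using snoc.prems unfolding mult_Suc_right by linarith
  have big: "zeta b (u @ [x]) ! ?i = (if ?i < nat x then zeta b u ! ?i
               else if ?i < nat x + b then Suc (length u) else zeta b u ! (?i - b))"
    using m i by (simp add: zeta_snoc insert_block_nth)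
  have small: "zeta 1 (map (class_count b q) (u @ [x])) ! p =
                 (if p < c then zeta 1 (map (class_count b q) u) ! p
                  else if p < c + 1 then Suc (length u)
                  else zeta 1 (map (class_count b q) u) ! (p - 1))"
    using c snoc.prems by (simp add: zeta_snoc insert_block_nth c_def)
  \<comment> \<open>The position lies behind the block iff the previous position of its class, \<open>b\<close> places
      to the left, does not lie in front of the block.\<close>
  have behind: "c < p \<longleftrightarrow> nat x + b \<le> ?i"
  proof (cases p)
    case 0
    then show ?thesis using snoc.prems by simp
  next
    case (Suc r)
    then show ?thesis using front[of r] by auto
  qed
  consider "p < c" | "p = c" | "c < p" by linarith
  then show ?case
  proof cases
    case 1
    then show ?thesis unfolding big small
      using front[of p] snoc.IH[OF u snoc.prems(2,3), of p] c by simp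
  next
    case 2
    then show ?thesis unfolding big small using front[of p] behind by simp
  next
    case 3
    then obtain r where r: "p = Suc r" by (cases p) auto
    have "zeta b (u @ [x]) ! ?i = zeta b u ! (b * r + (q - 1))"
      unfolding big using 3 front[of p] behind by (simp add: r)
    moreover have "zeta 1 (map (class_count b q) (u @ [x])) ! p
                     = zeta 1 (map (class_count b q) u) ! r"
      unfolding small using 3 by (simp add: r)
    ultimately show ?thesis
      using snoc.IH[OF u snoc.prems(2,3), of r] snoc.prems(4) by (simp add: r)
  qed
qed simp


section \<open>The ceilings distribute evenly\<close>

lemma class_count_eq:
  assumes "b > 0" "q \<le> b"
  shows "class_count b q x = x div int b + of_bool (int q \<le> x mod int b)"
proof -
  have r: "0 \<le> x mod int b" "x mod int b < int b" using assms by auto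
  have "x + int b - int q = (x mod int b + int b - int q) + int b * (x div int b)"
    by (simp add: algebra_simps)
  then have "class_count b q x = (x mod int b + int b - int q) div int b + x div int b"
    using assms unfolding class_count_def by (simp only: div_mult_self2 of_nat_eq_0_iff)
  moreover have "(x mod int b + int b - int q) div int b = of_bool (int q \<le> x mod int b)"
  proof (cases "int q \<le> x mod int b")
    case True
    then have "(x mod int b + int b - int q) div int b = 1"
      using r by (intro int_div_pos_eq[where r = "x mod int b - int q"]) auto
    then show ?thesis using True by simp
  next
    case False
    then have "(x mod int b + int b - int q) div int b = 0"
      using r assms by (intro div_pos_pos_trivial) linarith+
    then show ?thesis using False by simp
  qed
  ultimately show ?thesis using r by auto
qed

lemma sum_class_count:
  assumes "b > 0" "i < b"
  shows "(\<Sum>j\<in>{1..<Suc i}. class_count b j x)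
           = int i * (x div int b) + min (x mod int b) (int i)"
  using assms(2)
proof (induction i)
  case 0
  then show ?case using assms(1) by simp
next
  case (Suc i)
  have "(\<Sum>j\<in>{1..<Suc (Suc i)}. class_count b j x)
          = (\<Sum>j\<in>{1..<Suc i}. class_count b j x) + class_count b (Suc i) x"
    by simp
  also have "\<dots> = int i * (x div int b) + min (x mod int b) (int i) + x div int b
                    + of_bool (int (Suc i) \<le> x mod int b)"
    using Suc assms(1) by (simp add: class_count_eq)
  also have "\<dots> = int (Suc i) * (x div int b) + min (x mod int b) (int (Suc i))"
    by (auto simp: algebra_simps min_def)
  finally show ?case .
qed

text \<open>
  Write \<open>a * x = b * c + r\<close> with \<open>0 \<le> r < b\<close>. As long as fewer than \<open>r\<close> steps are made, the
  remainder left to be distributed exceeds \<open>c\<close> times the number of summands left, by less than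
  that number, and the ceiling is \<open>c + 1\<close>; thereafter the division is exact and yields \<open>c\<close>.
\<close>

lemma v_entry_eq:
  assumes "1 \<le> i" "i \<le> b"
  shows "v_entry a b x i = class_count b i (int a * x)"
  using assms
proof (induction i rule: less_induct)
  case (less i)
  let ?c = "int a * x div int b" and ?r = "int a * x mod int b"
  let ?d = "int b - int i + 1"
  have b: "b > 0" using less.prems by simp
  have d: "?d > 0" using less.prems by simp
  have r: "0 \<le> ?r" "?r < int b" using b by auto
  have "(\<Sum>j\<in>{1..<i}. v_entry a b x j) = (\<Sum>j\<in>{1..<i}. class_count b j (int a * x))"
    using less by (intro sum.cong) auto
  also have "\<dots> = (int i - 1) * ?c + min ?r (int i - 1)"
    using sum_class_count[OF b, of "i - 1" "int a * x"] less.prems by (simp add: of_nat_diff)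
  finally have sum: "(\<Sum>j\<in>{1..<i}. v_entry a b x j) = (int i - 1) * ?c + min ?r (int i - 1)" .
  have "int a * x = int b * ?c + ?r" by simp
  then have rest: "int a * x - (\<Sum>j\<in>{1..<i}. v_entry a b x j) = ?d * ?c + (?r - min ?r (int i - 1))"
    unfolding sum by (simp add: algebra_simps)
  have "v_entry a b x i = \<lceil>(real a * real_of_int x - (\<Sum>j\<in>{1..<i}. real_of_int (v_entry a b x j)))
                            / (real b - real i + 1)\<rceil>"
    by (rule v_entry.simps)
  also have "(real a * real_of_int x - (\<Sum>j\<in>{1..<i}. real_of_int (v_entry a b x j)))
                = real_of_int (int a * x - (\<Sum>j\<in>{1..<i}. v_entry a b x j))"
    by simp
  also have "\<dots> = real_of_int (?d * ?c + (?r - min ?r (int i - 1)))"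
    by (simp only: rest)
  also have "real b - real i + 1 = real_of_int ?d" by simp
  also have "real_of_int (?d * ?c + (?r - min ?r (int i - 1))) / real_of_int ?d
               = real_of_int (?r - min ?r (int i - 1)) / real_of_int ?d + real_of_int ?c"
    using d by (simp only: of_int_add of_int_mult add_divide_distrib) simp
  also have "\<lceil>\<dots>\<rceil> = \<lceil>real_of_int (?r - min ?r (int i - 1)) / real_of_int ?d\<rceil> + ?c"
    by (rule ceiling_add_of_int)
  also have "\<lceil>real_of_int (?r - min ?r (int i - 1)) / real_of_int ?d\<rceil> = of_bool (int i \<le> ?r)"
  proof (cases "int i \<le> ?r")
    case True
    then have "0 < ?r - min ?r (int i - 1)" "?r - min ?r (int i - 1) \<le> ?d"
      using r by auto
    then have "0 < real_of_int (?r - min ?r (int i - 1))"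
      "real_of_int (?r - min ?r (int i - 1)) \<le> real_of_int ?d" "0 < real_of_int ?d"
      using d by (simp_all only: of_int_0_less_iff of_int_le_iff)
    then have "\<lceil>real_of_int (?r - min ?r (int i - 1)) / real_of_int ?d\<rceil> = 1"
      by (intro ceiling_unique) (simp_all only: of_int_1 diff_self zero_less_divide_iff divide_le_eq_1, auto)
    then show ?thesis using True by simp
  next
    case False
    then have "?r - min ?r (int i - 1) = 0" by auto
    then show ?thesis using False by (simp only: of_int_0) simp
  qed
  finally show ?case using less.prems b by (simp add: class_count_eq)
qed


section \<open>The multi-permutation as an insertion word\<close>

lemma concat_consecutive_blocks:
  assumes "length w = b * M"
  shows "concat (map (\<lambda>p. map (\<lambda>q. w ! (b * (p - 1) + (q - 1))) [1..<b + 1]) [1..<M + 1]) = w"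
  using assms
proof (induction M arbitrary: w)
  case (Suc M)
  have len: "length w = b * M + b" using Suc.prems by simp
  have nth: "take (b * M) w ! (b * (p - 1) + (q - 1)) = w ! (b * (p - 1) + (q - 1))"
    if "p \<in> {1..<M + 1}" "q \<in> {1..<b + 1}" for p q
  proof -
    have "b * Suc (p - 1) \<le> b * M" using that by (intro mult_le_mono2) auto
    then show ?thesis using that by (intro nth_take) auto
  qed
  have "concat (map (\<lambda>p. map (\<lambda>q. w ! (b * (p - 1) + (q - 1))) [1..<b + 1]) [1..<M + 1])
          = concat (map (\<lambda>p. map (\<lambda>q. take (b * M) w ! (b * (p - 1) + (q - 1))) [1..<b + 1])
              [1..<M + 1])"
    by (intro arg_cong[of _ _ concat] map_cong refl) (simp_all only: set_upt nth)
  also have "\<dots> = take (b * M) w"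
    using Suc.IH[of "take (b * M) w"] len by simp
  finally have front: "concat (map (\<lambda>p. map (\<lambda>q. w ! (b * (p - 1) + (q - 1))) [1..<b + 1])
                         [1..<M + 1]) = take (b * M) w" .
  have last_block: "map (\<lambda>q. w ! (b * M + (q - 1))) [1..<b + 1] = drop (b * M) w"
    using len by (intro nth_equalityI) (auto simp del: upt_Suc)
  show ?case using front last_block by simp
qed simp

theorem mu_eq_zeta_scaled:
  assumes "insertion_seq b (map (\<lambda>x. int a * x) u)"
  shows "mu a b u = zeta_scaled a b u"
proof -
  let ?u = "map (\<lambda>x. int a * x) u"
  have "inverse_perm (eta (v_seq a b u q)) ! (p - 1) = zeta b ?u ! (b * (p - 1) + (q - 1))"
    if p: "p \<in> {1..<length u + 1}" and q: "q \<in> {1..<b + 1}" for p q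
  proof -
    have "v_seq a b u q = map (class_count b q) ?u"
      using q by (auto simp: v_seq_def v_entry_eq)
    moreover have "insertion_seq 1 (map (class_count b q) ?u)"
      using assms q by (intro insertion_seq_class_count) auto
    moreover have "zeta b ?u ! (b * (p - 1) + (q - 1))
                     = zeta 1 (map (class_count b q) ?u) ! (p - 1)"
      using assms p q by (intro zeta_nth_residue_class) auto
    ultimately show ?thesis by (simp only: inverse_perm_eta)
  qed
  then have "mu a b u = concat (map (\<lambda>p. map (\<lambda>q. zeta b ?u ! (b * (p - 1) + (q - 1)))
                                       [1..<b + 1]) [1..<length u + 1])"
    unfolding mu_def by (intro arg_cong[of _ _ concat] map_cong refl) (simp_all only: set_upt)
  also have "\<dots> = zeta b ?u" by (rule concat_consecutive_blocks) simp
  finally show ?thesis by (simp add: zeta_scaled_def)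
qed


section \<open>Step sequences of Dyck paths\<close>

lemma length_rel_step_seq:
  assumes "a > 0" "P \<in> dyck_paths a b n"
  shows "length (rel_step_seq a b n Q P) = a * n"
  using assms by (simp add: rel_step_seq_def step_seq_lowest_path length_step_seq del: upt_Suc)

lemma rel_step_seq_nth_bounds:
  assumes "a > 0" "b > 0" "P \<in> dyck_paths a b n" "k < a * n"
  shows "0 \<le> rel_step_seq a b n Q P ! k \<and> rel_step_seq a b n Q P ! k \<le> int (b * k div a)"
  using step_seq_nth_le[OF assms] assms
  by (auto simp: rel_step_seq_def step_seq_lowest_path length_step_seq simp del: upt_Suc)

lemma insertion_seq_rel_step_seq:
  assumes "a > 0" "b > 0" "P \<in> dyck_paths a b n"
  shows "insertion_seq b (map (\<lambda>x. int a * x) (rel_step_seq a b n Q P))"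
  unfolding insertion_seq_def
proof (intro allI impI)
  let ?u = "rel_step_seq a b n Q P"
  fix k assume k: "k < length (map (\<lambda>x. int a * x) ?u)"
  then have u: "0 \<le> ?u ! k" "?u ! k \<le> int (b * k div a)"
    using rel_step_seq_nth_bounds[OF assms, of k Q] length_rel_step_seq[OF assms(1,3)] by auto
  have "int a * ?u ! k \<le> int (a * (b * k div a))"
    using u(2) by (simp only: of_nat_mult mult_left_mono of_nat_0_le_iff)
  also have "\<dots> \<le> int (b * k)" by (simp only: of_nat_le_iff times_div_less_eq_dividend)
  finally show "0 \<le> map (\<lambda>x. int a * x) ?u ! k \<and> map (\<lambda>x. int a * x) ?u ! k \<le> int b * int k"
    using u(1) k by simp
qed

theorem theorem6p7:
  fixes a b n :: nat and P Q :: "step list"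
  assumes "a > 0" and "b > 0" and "coprime a b" and "n \<ge> 1"
    and "P \<in> dyck_paths a b n"
    and "Q \<in> {lowest_path a b n, highest_path a b n}"
  shows "is_stirling_perm b (a * n) (mu a b (rel_step_seq a b n Q P)) \<and>
    mu a b (rel_step_seq a b n Q P) = zeta_scaled a b (rel_step_seq a b n Q P)"
proof -
  let ?u = "rel_step_seq a b n Q P"
  have adm: "insertion_seq b (map (\<lambda>x. int a * x) ?u)"
    using assms by (intro insertion_seq_rel_step_seq)
  then have "is_stirling_perm b (a * n) (zeta_scaled a b ?u)"
    using is_stirling_perm_zeta[OF adm] length_rel_step_seq[OF assms(1,5)]
    by (simp add: zeta_scaled_def)
  then show ?thesis using mu_eq_zeta_scaled[OF adm] by simp
qed

end
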